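(* Let $\mathcal{C}_1=\{\mathbf{P}_4,\mathbf{L}_3\}$ and $\mathcal{C}_2=\{\mathbf{Q}_6,\mathbf{Q}_4\}$, where $\mathbf{L}_3,\mathbf{P}_4,\mathbf{Q}_4,\mathbf{Q}_6$ are the finite bounded pocrims specified in the context. Then: (i) the Gentzen semantics $\mu^{\mathsf{Gen}}$ is a double negation semantics for $\mathcal{C}_1$, but the Glivenko semantics $\mu^{\mathsf{Gli}}$ is not; (ii) the Glivenko semantics $\mu^{\mathsf{Gli}}$ is a double negation semantics for $\mathcal{C}_2$, but the Gentzen semantics $\mu^{\mathsf{Gen}}$ is not.
   Context: A pocrim is a structure $\mathbf{P}=(P;0,+,\rightarrow)$ such that, writing $x\ge y$ for $x\rightarrow y=0$: $(P;0,+)$ is a commutative monoid; $\ge$ is a partial order on $P$; $x\ge y$ implies $x+z\ge y+z$; $x\ge 0$ for all $x$; and $x+y\ge z$ iff $x\ge y\rightarrow z$. A pocrim is bounded if it has an element $1$ with $x+1=1$ for all $x$; then $\neg x=x\rightarrow 1$ and $\delta(x)=\neg\neg x$. A bounded pocrim is involutive if $\delta(x)=x$ for all $x$. Homomorphisms of bounded pocrims preserve $0,1,+,\rightarrow$. The finite pocrims: $\mathbf{L}_3$ has universe $\{0,\tfrac12,1\}$ with $x+y$ the truncated sum $\min(x+y,1)$ and $x\rightarrow y=\max(y-x,0)$. $\mathbf{P}_4$ is the chain $0<p<q<1$ with \[\begin{array}{c|cccc} + &0&p&q&1\\\hline 0&0&p&q&1\\ p&p&1&1&1\\ q&q&1&1&1\\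 1&1&1&1&1\end{array}\qquad \begin{array}{c|cccc} \rightarrow &0&p&q&1\\\hline 0&0&p&q&1\\ p&0&0&p&p\\ q&0&0&0&p\\ 1&0&0&0&0\end{array}\] $\mathbf{Q}_4$ is the chain $0<u<v<1$ with \[\begin{array}{c|cccc} + &0&u&v&1\\\hline 0&0&u&v&1\\ u&u&u&1&1\\ v&v&1&1&1\\ 1&1&1&1&1\end{array}\qquad \begin{array}{c|cccc} \rightarrow &0&u&v&1\\\hline 0&0&u&v&1\\ u&0&0&v&v\\ v&0&0&0&u\\ 1&0&0&0&0\end{array}\] $\mathbf{Q}_6$ is the chain $0<p<q<r<s<1$ with \[\begin{array}{c|cccccc} + &0&p&q&r&s&1\\\hline 0&0&p&q&r&s&1\\ p&p&p&r&r&s&1\\ q&q&r&r&r&1&1\\ r&r&r&r&r&1&1\\ s&s&s&1&1&1&1\\ 1&1&1&1&1&1&1\end{array}\qquad \begin{array}{c|cccccc} \rightarrow &0&p&q&r&s&1\\\hline 0&0&p&q&r&s&1\\ p&0&0&q&q&s&1\\ q&0&0&0&p&s&s\\ r&0&0&0&0&s&s\\ s&0&0&0&0&0&q\\ 1&0&0&0&0&0&0\end{array}\] (the entry in row $x$, column $y$ of the right-hand tables is $x\rightarrow y$). $\mathcal{L}$ is the set of formulas built from a countable set of variables $\mathrm{Var}=\{V_1,V_2,\ldots\}$ and the constant $1$ using binary connectives $\otimes$ and $\multimap$. A semantics is a family $\mu$ of functions $\mu_{\mathbf P}$, one for each bounded pocrim $\mathbf{P}$, mapping each assignment $\alpha:\mathrm{Var}\to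 P$ to a function $\mu_{\mathbf P}(\alpha):\mathcal{L}\to P$, that is natural: for every homomorphism of bounded pocrims $h:\mathbf{P}\to\mathbf{Q}$, $\mu_{\mathbf Q}(h\circ\alpha)=h\circ\mu_{\mathbf P}(\alpha)$. The standard semantics $\mu^{\mathsf S}$ is given by $\mu^{\mathsf S}_{\mathbf P}(\alpha)(V_i)=\alpha(V_i)$, $\mu^{\mathsf S}_{\mathbf P}(\alpha)(1)=1$, and interpreting $\otimes$ as $+$ and $\multimap$ as $\rightarrow$. The Gentzen semantics is $\mu^{\mathsf{Gen}}_{\mathbf P}(\alpha)=\mu^{\mathsf S}_{\mathbf P}(\delta\circ\alpha)$. The Glivenko semantics is $\mu^{\mathsf{Gli}}_{\mathbf P}(\alpha)=\delta\circ\mu^{\mathsf S}_{\mathbf P}(\alpha)$. Write $\delta^{\mathcal L}$ for the family of maps $\delta^{\mathcal L}_{\mathbf P}$, one for each bounded pocrim $\mathbf{P}$, sending a function $f:\mathcal{L}\to P$ to $\delta\circ f$. For a class $\mathcal{C}$ of bounded pocrims, a semantics $\mu$ is a double negation semantics for $\mathcal{C}$ if: (DNS1) if $\mathbf{P}\in\mathcal{C}$ is involutive then $\mu_{\mathbf P}=\mu^{\mathsf S}_{\mathbf P}$; (DNS2) for every formula $A$, if $\mu^{\mathsf S}_{\mathbf P}(\alpha)(A)=0$ for every involutive $\mathbf{P}\in\mathcal{C}$ and every $\alpha:\mathrm{Var}\to P$, then $\mu_{\mathbf P}(\alpha)(A)=0$ for every $\mathbf{P}\in\mathcal{C}$ and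 every $\alpha:\mathrm{Var}\to P$; (DNS3) $\delta^{\mathcal L}\circ\mu=\mu$, i.e. $\delta\circ\mu_{\mathbf P}(\alpha)=\mu_{\mathbf P}(\alpha)$ for every bounded pocrim $\mathbf{P}$ and every $\alpha:\mathrm{Var}\to P$.
   Formalization: (DNS3) is required only for P in the class C, not for every bounded pocrim; as worded it fails for the Gentzen semantics at Q6 (δ(q)=q but δ(q+q)=δ(r)=q≠r), so (i) would be false. For Glivenko in (ii), (DNS3) is still proved for all bounded pocrims. *)

theory Defs
  imports Complex_Main "HOL-Algebra.Group"
begin

text \<open>
  The monoid is written additively, with neutral element \<open>pzero\<close>, and the order is
  reversed with respect to many presentations: \<open>pzero\<close> is the least element and stands for truth,
  \<open>pone\<close> is the greatest element and stands for falsehood.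
\<close>

record 'a pocrim = "'a partial_object" +
  pzero :: 'a
  pplus :: "'a \<Rightarrow> 'a \<Rightarrow> 'a"
  pimp :: "'a \<Rightarrow> 'a \<Rightarrow> 'a"

record 'a bpocrim = "'a pocrim" +
  pone :: 'a

definition pge :: "('a, 'm) pocrim_scheme \<Rightarrow> 'a \<Rightarrow> 'a \<Rightarrow> bool" where
  "pge P x y \<longleftrightarrow> pimp P x y = pzero P"

definition is_pocrim :: "('a, 'm) pocrim_scheme \<Rightarrow> bool" where
  "is_pocrim P \<longleftrightarrow>
     comm_monoid \<lparr>carrier = carrier P, mult = pplus P, one = pzero P\<rparr> \<and>
     (\<forall>x\<in>carrier P. \<forall>y\<in>carrier P. pimp P x y \<in> carrier P) \<and>
     partial_order_on (carrier P) {(x, y). x \<in> carrier P \<and> y \<in> carrier P \<and> pge P x y} \<and>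
     (\<forall>x\<in>carrier P. \<forall>y\<in>carrier P. \<forall>z\<in>carrier P.
        pge P x y \<longrightarrow> pge P (pplus P x z) (pplus P y z)) \<and>
     (\<forall>x\<in>carrier P. pge P x (pzero P)) \<and>
     (\<forall>x\<in>carrier P. \<forall>y\<in>carrier P. \<forall>z\<in>carrier P.
        pge P (pplus P x y) z \<longleftrightarrow> pge P x (pimp P y z))"

definition bounded_pocrim :: "'a bpocrim \<Rightarrow> bool" where
  "bounded_pocrim P \<longleftrightarrow>
     is_pocrim P \<and> pone P \<in> carrier P \<and> (\<forall>x\<in>carrier P. pplus P x (pone P) = pone P)"

definition pneg :: "'a bpocrim \<Rightarrow> 'a \<Rightarrow> 'a" where
  "pneg P x = pimp P x (pone P)"

definition dneg :: "'a bpocrim \<Rightarrow> 'a \<Rightarrow> 'a" where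
  "dneg P x = pneg P (pneg P x)"

definition involutive :: "'a bpocrim \<Rightarrow> bool" where
  "involutive P \<longleftrightarrow> (\<forall>x\<in>carrier P. dneg P x = x)"

definition bpocrim_hom :: "'a bpocrim \<Rightarrow> 'b bpocrim \<Rightarrow> ('a \<Rightarrow> 'b) \<Rightarrow> bool" where
  "bpocrim_hom P Q h \<longleftrightarrow>
     bounded_pocrim P \<and> bounded_pocrim Q \<and>
     h \<in> carrier P \<rightarrow> carrier Q \<and>
     h (pzero P) = pzero Q \<and> h (pone P) = pone Q \<and>
     (\<forall>x\<in>carrier P. \<forall>y\<in>carrier P. h (pplus P x y) = pplus Q (h x) (h y)) \<and>
     (\<forall>x\<in>carrier P. \<forall>y\<in>carrier P. h (pimp P x y) = pimp Q (h x) (h y))"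

text \<open>
  The two carrier types may differ: the concrete pocrims below live in types of their own, and their
  isomorphic copies exist in every type with at least six elements, by transport along an injection.
\<close>

definition bpocrim_iso :: "'a bpocrim \<Rightarrow> 'b bpocrim \<Rightarrow> bool" where
  "bpocrim_iso P Q \<longleftrightarrow> (\<exists>h. bpocrim_hom P Q h \<and> bij_betw h (carrier P) (carrier Q))"

definition std_L3 :: "real bpocrim" where
  "std_L3 = \<lparr>carrier = {0, 1/2, 1}, pzero = 0,
     pplus = (\<lambda>x y. min (x + y) 1), pimp = (\<lambda>x y. max (y - x) 0), pone = 1\<rparr>"

text \<open>
  One type of labels serves the three pocrims that are given by tables; the carriers pick out the
  labels that are used. In \<open>table es t\<close> both rows and columns are labelled by \<open>es\<close>, in order.
\<close>

datatype elt = E0 | Ep | Eq | Er | Es | Eu | Ev | E1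

definition position :: "'e list \<Rightarrow> 'e \<Rightarrow> nat" where
  "position es x = length (takeWhile (\<lambda>z. z \<noteq> x) es)"

definition table :: "'e list \<Rightarrow> 'e list list \<Rightarrow> 'e \<Rightarrow> 'e \<Rightarrow> 'e" where
  "table es t x y = t ! position es x ! position es y"

definition std_P4 :: "elt bpocrim" where
  "std_P4 = \<lparr>carrier = {E0, Ep, Eq, E1}, pzero = E0,
     pplus = table [E0, Ep, Eq, E1]
       [[E0, Ep, Eq, E1],
        [Ep, E1, E1, E1],
        [Eq, E1, E1, E1],
        [E1, E1, E1, E1]],
     pimp = table [E0, Ep, Eq, E1]
       [[E0, Ep, Eq, E1],
        [E0, E0, Ep, Ep],
        [E0, E0, E0, Ep],
        [E0, E0, E0, E0]],
     pone = E1\<rparr>"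

definition std_Q4 :: "elt bpocrim" where
  "std_Q4 = \<lparr>carrier = {E0, Eu, Ev, E1}, pzero = E0,
     pplus = table [E0, Eu, Ev, E1]
       [[E0, Eu, Ev, E1],
        [Eu, Eu, E1, E1],
        [Ev, E1, E1, E1],
        [E1, E1, E1, E1]],
     pimp = table [E0, Eu, Ev, E1]
       [[E0, Eu, Ev, E1],
        [E0, E0, Ev, Ev],
        [E0, E0, E0, Eu],
        [E0, E0, E0, E0]],
     pone = E1\<rparr>"

definition std_Q6 :: "elt bpocrim" where
  "std_Q6 = \<lparr>carrier = {E0, Ep, Eq, Er, Es, E1}, pzero = E0,
     pplus = table [E0, Ep, Eq, Er, Es, E1]
       [[E0, Ep, Eq, Er, Es, E1],
        [Ep, Ep, Er, Er, Es, E1],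
        [Eq, Er, Er, Er, E1, E1],
        [Er, Er, Er, Er, E1, E1],
        [Es, Es, E1, E1, E1, E1],
        [E1, E1, E1, E1, E1, E1]],
     pimp = table [E0, Ep, Eq, Er, Es, E1]
       [[E0, Ep, Eq, Er, Es, E1],
        [E0, E0, Eq, Eq, Es, E1],
        [E0, E0, E0, Ep, Es, Es],
        [E0, E0, E0, E0, Es, Es],
        [E0, E0, E0, E0, E0, Eq],
        [E0, E0, E0, E0, E0, E0]],
     pone = E1\<rparr>"

lemma bounded_pocrim_direct:
  assumes "\<And>x y. x \<in> carrier P \<Longrightarrow> y \<in> carrier P \<Longrightarrow> pplus P x y \<in> carrier P"
    and "\<And>x y. x \<in> carrier P \<Longrightarrow> y \<in> carrier P \<Longrightarrow> pimp P x y \<in> carrier P"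
    and "pzero P \<in> carrier P" "pone P \<in> carrier P"
    and "\<And>x y z. x \<in> carrier P \<Longrightarrow> y \<in> carrier P \<Longrightarrow> z \<in> carrier P \<Longrightarrow>
          pplus P (pplus P x y) z = pplus P x (pplus P y z)"
    and "\<And>x y. x \<in> carrier P \<Longrightarrow> y \<in> carrier P \<Longrightarrow> pplus P x y = pplus P y x"
    and "\<And>x. x \<in> carrier P \<Longrightarrow> pplus P (pzero P) x = x"
    and "\<And>x. x \<in> carrier P \<Longrightarrow> pplus P x (pone P) = pone P"
    and "\<And>x. x \<in> carrier P \<Longrightarrow> pge P x x"
    and "\<And>x y. x \<in> carrier P \<Longrightarrow> y \<in> carrier P \<Longrightarrow> pge P x y \<Longrightarrow> pge P y x \<Longrightarrow> x = y"
    and "\<And>x y z. x \<in> carrier P \<Longrightarrow> y \<in> carrier P \<Longrightarrow> z \<in> carrier P \<Longrightarrow>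
          pge P x y \<Longrightarrow> pge P y z \<Longrightarrow> pge P x z"
    and "\<And>x y z. x \<in> carrier P \<Longrightarrow> y \<in> carrier P \<Longrightarrow> z \<in> carrier P \<Longrightarrow>
          pge P x y \<Longrightarrow> pge P (pplus P x z) (pplus P y z)"
    and "\<And>x. x \<in> carrier P \<Longrightarrow> pge P x (pzero P)"
    and "\<And>x y z. x \<in> carrier P \<Longrightarrow> y \<in> carrier P \<Longrightarrow> z \<in> carrier P \<Longrightarrow>
          pge P (pplus P x y) z \<longleftrightarrow> pge P x (pimp P y z)"
  shows "bounded_pocrim P"
proof -
  have mon: "comm_monoid \<lparr>carrier = carrier P, mult = pplus P, one = pzero P\<rparr>"
    by (rule comm_monoidI) (use assms(1,3,5,6,7) in simp_all)
  have ord: "partial_order_on (carrier P)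
      {(x, y). x \<in> carrier P \<and> y \<in> carrier P \<and> pge P x y}"
    unfolding partial_order_on_def preorder_on_def
  proof (intro conjI)
    show "refl_on (carrier P) {(x, y). x \<in> carrier P \<and> y \<in> carrier P \<and> pge P x y}"
      using assms(9) by (auto intro!: refl_onI)
    show "trans {(x, y). x \<in> carrier P \<and> y \<in> carrier P \<and> pge P x y}"
      by (rule transI) (use assms(11) in auto)
    show "antisym {(x, y). x \<in> carrier P \<and> y \<in> carrier P \<and> pge P x y}"
      by (rule antisymI) (use assms(10) in auto)
  qed auto
  show ?thesis
    unfolding bounded_pocrim_def is_pocrim_def
    by (intro conjI ballI impI; (rule mon | rule ord | (rule assms; assumption)))
qed

lemma bounded_pocrim_std_L3: "bounded_pocrim std_L3"
  by (rule bounded_pocrim_direct) (auto simp: std_L3_def pge_def)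

definition finite_check :: "elt bpocrim \<Rightarrow> bool" where
  "finite_check P \<longleftrightarrow>
     pzero P \<in> carrier P \<and> pone P \<in> carrier P \<and>
     (\<forall>x\<in>carrier P. pplus P (pzero P) x = x \<and> pplus P x (pone P) = pone P \<and>
        pge P x x \<and> pge P x (pzero P)) \<and>
     (\<forall>x\<in>carrier P. \<forall>y\<in>carrier P. pplus P x y \<in> carrier P \<and> pimp P x y \<in> carrier P \<and>
        pplus P x y = pplus P y x \<and> (pge P x y \<longrightarrow> pge P y x \<longrightarrow> x = y)) \<and>
     (\<forall>x\<in>carrier P. \<forall>y\<in>carrier P. \<forall>z\<in>carrier P.
        pplus P (pplus P x y) z = pplus P x (pplus P y z) \<and>
        (pge P x y \<longrightarrow> pge P y z \<longrightarrow> pge P x z) \<and>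
        (pge P x y \<longrightarrow> pge P (pplus P x z) (pplus P y z)) \<and>
        (pge P (pplus P x y) z \<longleftrightarrow> pge P x (pimp P y z)))"

lemma bounded_pocrim_finite_check: "finite_check P \<Longrightarrow> bounded_pocrim P"
  by (rule bounded_pocrim_direct) (unfold finite_check_def, blast+)

lemma bounded_pocrim_std_P4: "bounded_pocrim std_P4"
  by (rule bounded_pocrim_finite_check) code_simp

lemma bounded_pocrim_std_Q4: "bounded_pocrim std_Q4"
  by (rule bounded_pocrim_finite_check) code_simp

lemma bounded_pocrim_std_Q6: "bounded_pocrim std_Q6"
  by (rule bounded_pocrim_finite_check) code_simp

text \<open>\<open>Falsum\<close> is the constant formula 1.\<close>

datatype form = Var nat | Falsum | Tensor form form | Lolli form form

text \<open>
  A semantics is a family over all bounded pocrims, a proper class. Here it is a family over all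
  bounded pocrims whose carrier is a set of elements of the type \<open>'a\<close>; theorems that leave \<open>'a\<close>
  free cover every universe of discourse. Only values at bounded pocrims \<open>P\<close> and at assignments
  into the carrier of \<open>P\<close> are meaningful.
\<close>

type_synonym 'a family = "'a bpocrim \<Rightarrow> (nat \<Rightarrow> 'a) \<Rightarrow> form \<Rightarrow> 'a"

definition assignments :: "'a bpocrim \<Rightarrow> (nat \<Rightarrow> 'a) set" where
  "assignments P = UNIV \<rightarrow> carrier P"

definition is_semantics :: "'a family \<Rightarrow> bool" where
  "is_semantics \<mu> \<longleftrightarrow>
     (\<forall>P. bounded_pocrim P \<longrightarrow> (\<forall>\<alpha>\<in>assignments P. \<mu> P \<alpha> \<in> UNIV \<rightarrow> carrier P)) \<and>
     (\<forall>P Q h. bpocrim_hom P Q h \<longrightarrow> (\<forall>\<alpha>\<in>assignments P. \<mu> Q (h \<circ> \<alpha>) = h \<circ> \<mu> P \<alpha>))"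

primrec standard :: "'a family" where
  "standard P \<alpha> (Var i) = \<alpha> i"
| "standard P \<alpha> Falsum = pone P"
| "standard P \<alpha> (Tensor A B) = pplus P (standard P \<alpha> A) (standard P \<alpha> B)"
| "standard P \<alpha> (Lolli A B) = pimp P (standard P \<alpha> A) (standard P \<alpha> B)"

definition gentzen :: "'a family" where
  "gentzen P \<alpha> = standard P (dneg P \<circ> \<alpha>)"

definition glivenko :: "'a family" where
  "glivenko P \<alpha> = dneg P \<circ> standard P \<alpha>"

definition DNS1 :: "'a bpocrim set \<Rightarrow> 'a family \<Rightarrow> bool" where
  "DNS1 C \<mu> \<longleftrightarrow> (\<forall>P\<in>C. involutive P \<longrightarrow> (\<forall>\<alpha>\<in>assignments P. \<mu> P \<alpha> = standard P \<alpha>))"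

definition DNS2 :: "'a bpocrim set \<Rightarrow> 'a family \<Rightarrow> bool" where
  "DNS2 C \<mu> \<longleftrightarrow>
     (\<forall>A. (\<forall>P\<in>C. involutive P \<longrightarrow> (\<forall>\<alpha>\<in>assignments P. standard P \<alpha> A = pzero P)) \<longrightarrow>
          (\<forall>P\<in>C. \<forall>\<alpha>\<in>assignments P. \<mu> P \<alpha> A = pzero P))"

definition DNS3 :: "'a bpocrim set \<Rightarrow> 'a family \<Rightarrow> bool" where
  "DNS3 C \<mu> \<longleftrightarrow> (\<forall>P\<in>C. \<forall>\<alpha>\<in>assignments P. dneg P \<circ> \<mu> P \<alpha> = \<mu> P \<alpha>)"

text \<open>
  Like the other two conditions, \<open>DNS3\<close> is required on \<open>C\<close> only. On the class of all bounded pocrims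
  it fails for the Gentzen semantics, so that requiring it there would exclude the Gentzen
  semantics whatever \<open>C\<close> is: in \<open>std_Q6\<close> the element \<open>q\<close> is a fixed point of double negation
  but \<open>q + q = r\<close> is not (lemma \<open>not_DNS3_gentzen\<close>).
\<close>

definition double_negation_semantics :: "'a bpocrim set \<Rightarrow> 'a family \<Rightarrow> bool" where
  "double_negation_semantics C \<mu> \<longleftrightarrow> is_semantics \<mu> \<and> DNS1 C \<mu> \<and> DNS2 C \<mu> \<and> DNS3 C \<mu>"

lemma not_DNS3_gentzen: "\<not> DNS3 {P. bounded_pocrim P} (gentzen :: elt family)"
proof
  assume "DNS3 {P. bounded_pocrim P} (gentzen :: elt family)"
  moreover have "(\<lambda>_. Eq) \<in> assignments std_Q6"
    by (simp add: assignments_def std_Q6_def)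
  ultimately have "dneg std_Q6 \<circ> gentzen std_Q6 (\<lambda>_. Eq) = gentzen std_Q6 (\<lambda>_. Eq)"
    using bounded_pocrim_std_Q6 unfolding DNS3_def by blast
  then have "(dneg std_Q6 \<circ> gentzen std_Q6 (\<lambda>_. Eq)) (Tensor (Var 0) (Var 0)) =
      gentzen std_Q6 (\<lambda>_. Eq) (Tensor (Var 0) (Var 0))"
    by (rule fun_cong)
  moreover have "(dneg std_Q6 \<circ> gentzen std_Q6 (\<lambda>_. Eq)) (Tensor (Var 0) (Var 0)) \<noteq>
      gentzen std_Q6 (\<lambda>_. Eq) (Tensor (Var 0) (Var 0))"
    by code_simp
  ultimately show False by contradiction
qed

end

(*
  In P4 the image {0, p, 1} of double negation is a subalgebra isomorphic to the involutive
  pocrim L3, so the Gentzen semantics on P4 is computed inside L3. Dually, collapsing 0 with p and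
  q with r is a homomorphism from Q6 onto the involutive pocrim Q4 whose kernel consists of
  elements with double negation 0, so Glivenko validity in Q6 follows from validity in Q4.
  The Glivenko semantics fails on P4 for double negation elimination evaluated at q; the Gentzen
  semantics fails on Q6 because q is a fixed point of double negation while q + q = r is not.
*)

theory Submission
  imports Defs
begin

section \<open>Elementwise laws and double negation in a bounded pocrim\<close>

lemma bounded_pocrimD:
  assumes "bounded_pocrim P"
  shows "pzero P \<in> carrier P" and "pone P \<in> carrier P"
    and "\<And>x y. x \<in> carrier P \<Longrightarrow> y \<in> carrier P \<Longrightarrow> pplus P x y \<in> carrier P"
    and "\<And>x y. x \<in> carrier P \<Longrightarrow> y \<in> carrier P \<Longrightarrow> pimp P x y \<in> carrier P"
    and "\<And>x y. x \<in> carrier P \<Longrightarrow> y \<in> carrier P \<Longrightarrow> pplus P x y = pplus P y x"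
    and "\<And>x. x \<in> carrier P \<Longrightarrow> pge P x x"
    and "\<And>x y. x \<in> carrier P \<Longrightarrow> y \<in> carrier P \<Longrightarrow> pge P x y \<Longrightarrow> pge P y x \<Longrightarrow> x = y"
    and "\<And>x y z. x \<in> carrier P \<Longrightarrow> y \<in> carrier P \<Longrightarrow> z \<in> carrier P \<Longrightarrow>
          pge P x y \<Longrightarrow> pge P y z \<Longrightarrow> pge P x z"
    and "\<And>x y z. x \<in> carrier P \<Longrightarrow> y \<in> carrier P \<Longrightarrow> z \<in> carrier P \<Longrightarrow>
          pge P (pplus P x y) z \<longleftrightarrow> pge P x (pimp P y z)"
proof -
  have pocrim: "is_pocrim P"
    and one: "pone P \<in> carrier P"
    using assms by (auto simp: bounded_pocrim_def)
  interpret comm_monoid "\<lparr>carrier = carrier P, mult = pplus P, one = pzero P\<rparr>"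
    using pocrim by (simp add: is_pocrim_def)
  have po: "partial_order_on (carrier P)
      {(x, y). x \<in> carrier P \<and> y \<in> carrier P \<and> pge P x y}"
    using pocrim by (simp add: is_pocrim_def)
  show "pzero P \<in> carrier P" using one_closed by simp
  show "pone P \<in> carrier P" by (fact one)
  show "\<And>x y. x \<in> carrier P \<Longrightarrow> y \<in> carrier P \<Longrightarrow> pplus P x y \<in> carrier P"
    using m_closed by simp
  show "\<And>x y. x \<in> carrier P \<Longrightarrow> y \<in> carrier P \<Longrightarrow> pplus P x y = pplus P y x"
    using m_comm by simp
  show "\<And>x. x \<in> carrier P \<Longrightarrow> pge P x x"
    using po by (auto simp: partial_order_on_def preorder_on_def refl_on_def)
  show "\<And>x y. x \<in> carrier P \<Longrightarrow> y \<in> carrier P \<Longrightarrow> pge P x y \<Longrightarrow> pge P y x \<Longrightarrow> x = y"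
    using po by (auto simp: partial_order_on_def dest: antisymD)
  show "\<And>x y z. x \<in> carrier P \<Longrightarrow> y \<in> carrier P \<Longrightarrow> z \<in> carrier P \<Longrightarrow>
      pge P x y \<Longrightarrow> pge P y z \<Longrightarrow> pge P x z"
    using po unfolding partial_order_on_def preorder_on_def trans_def by blast
qed (use assms[unfolded bounded_pocrim_def is_pocrim_def] in blast)+

lemma pneg_closed: "bounded_pocrim P \<Longrightarrow> x \<in> carrier P \<Longrightarrow> pneg P x \<in> carrier P"
  by (simp add: pneg_def bounded_pocrimD(2,4))

lemma dneg_closed: "bounded_pocrim P \<Longrightarrow> x \<in> carrier P \<Longrightarrow> dneg P x \<in> carrier P"
  by (simp add: dneg_def pneg_closed)

text \<open>By residuation and commutativity, both sides say
  \<open>pge P (pplus P x y) (pone P)\<close>. Thus negation forms an antitone Galois connection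
  with itself, and the laws of double negation below follow from this.\<close>

lemma pge_pneg_iff:
  assumes P: "bounded_pocrim P" and x: "x \<in> carrier P" and y: "y \<in> carrier P"
  shows "pge P x (pneg P y) \<longleftrightarrow> pge P y (pneg P x)"
proof -
  note P' = bounded_pocrimD[OF P]
  show ?thesis
    unfolding pneg_def
    using P'(5)[OF x y] P'(9)[OF x y P'(2)] P'(9)[OF y x P'(2)] by simp
qed

text \<open>Unit of the Galois connection: with \<open>pneg P x\<close> in place of \<open>y\<close>
  the other side is reflexivity. In this order double negation moves an element down, towards
  \<open>pzero P\<close>.\<close>

lemma pge_dneg: "bounded_pocrim P \<Longrightarrow> x \<in> carrier P \<Longrightarrow> pge P x (dneg P x)"
  by (simp add: dneg_def pge_pneg_iff[of P x] pneg_closed bounded_pocrimD(6))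

lemma pneg_antimono:
  assumes P: "bounded_pocrim P" and x: "x \<in> carrier P" and y: "y \<in> carrier P"
    and xy: "pge P x y"
  shows "pge P (pneg P y) (pneg P x)"
proof -
  have "pge P x (dneg P y)"
    by (rule bounded_pocrimD(8)[OF P x y dneg_closed[OF P y] xy pge_dneg[OF P y]])
  then show ?thesis
    using pge_pneg_iff[OF P x pneg_closed[OF P y]] by (simp add: dneg_def)
qed

text \<open>Triple negation collapses to single negation: antitonicity applied to
  \<open>pge_dneg\<close> at \<open>x\<close> gives one inequality, \<open>pge_dneg\<close> at
  \<open>pneg P x\<close> gives the other.\<close>

lemma dneg_pneg:
  assumes P: "bounded_pocrim P" and x: "x \<in> carrier P"
  shows "dneg P (pneg P x) = pneg P x"
proof (rule bounded_pocrimD(7)[OF P])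
  show "pge P (dneg P (pneg P x)) (pneg P x)"
    using pneg_antimono[OF P x dneg_closed[OF P x] pge_dneg[OF P x]] by (simp add: dneg_def)
qed (use assms in \<open>simp_all add: dneg_closed pneg_closed pge_dneg\<close>)

lemma dneg_dneg: "bounded_pocrim P \<Longrightarrow> x \<in> carrier P \<Longrightarrow> dneg P (dneg P x) = dneg P x"
  using dneg_pneg[of P "pneg P x"] pneg_closed[of P x] by (simp add: dneg_def[of P x])

section \<open>Homomorphisms and isomorphisms\<close>

lemma bpocrim_homD:
  assumes "bpocrim_hom P Q h"
  shows "bounded_pocrim P" and "bounded_pocrim Q"
    and "\<And>x. x \<in> carrier P \<Longrightarrow> h x \<in> carrier Q"
    and "h (pzero P) = pzero Q" and "h (pone P) = pone Q"
    and "\<And>x y. x \<in> carrier P \<Longrightarrow> y \<in> carrier P \<Longrightarrow> h (pplus P x y) = pplus Q (h x) (h y)"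
    and "\<And>x y. x \<in> carrier P \<Longrightarrow> y \<in> carrier P \<Longrightarrow> h (pimp P x y) = pimp Q (h x) (h y)"
  using assms by (auto simp: bpocrim_hom_def)

lemma hom_pneg: "bpocrim_hom P Q h \<Longrightarrow> x \<in> carrier P \<Longrightarrow> h (pneg P x) = pneg Q (h x)"
  using bounded_pocrimD(2)[of P] by (simp add: pneg_def bpocrim_homD)

lemma hom_dneg: "bpocrim_hom P Q h \<Longrightarrow> x \<in> carrier P \<Longrightarrow> h (dneg P x) = dneg Q (h x)"
  by (simp add: dneg_def hom_pneg bpocrim_homD(1) pneg_closed)

lemma bpocrim_hom_comp:
  "bpocrim_hom P Q h \<Longrightarrow> bpocrim_hom Q R k \<Longrightarrow> bpocrim_hom P R (k \<circ> h)"
  by (auto simp: bpocrim_hom_def Pi_iff)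

text \<open>The order is given by the equation \<open>pimp P x y = pzero P\<close>, so homomorphisms
  are purely algebraic and a bijective one has a homomorphic inverse.\<close>

lemma bpocrim_hom_inv:
  assumes h: "bpocrim_hom P Q h" and bij: "bij_betw h (carrier P) (carrier Q)"
  shows "bpocrim_hom Q P (inv_into (carrier P) h)" (is "bpocrim_hom Q P ?k")
proof -
  note h' = bpocrim_homD[OF h]
  note P' = bounded_pocrimD[OF h'(1)]
  have kh: "?k (h x) = x" if "x \<in> carrier P" for x
    by (rule bij_betw_inv_into_left[OF bij that])
  have surj: "\<exists>x\<in>carrier P. y = h x" if "y \<in> carrier Q" for y
    using bij that by (auto simp: bij_betw_def)
  have preserves: "?k (pplus Q (h x) (h x')) = pplus P x x'" "?k (pimp Q (h x) (h x')) = pimp P x x'"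
    if "x \<in> carrier P" "x' \<in> carrier P" for x x'
    using that kh[of "pplus P x x'"] kh[of "pimp P x x'"] by (simp_all add: h' P'(3,4))
  show ?thesis
    unfolding bpocrim_hom_def
  proof (intro conjI ballI)
    show "?k \<in> carrier Q \<rightarrow> carrier P" using kh surj by fastforce
    show "?k (pzero Q) = pzero P" "?k (pone Q) = pone P"
      using kh[OF P'(1)] kh[OF P'(2)] by (simp_all add: h')
    fix y y' assume "y \<in> carrier Q" "y' \<in> carrier Q"
    then obtain x x' where "x \<in> carrier P" "y = h x" "x' \<in> carrier P" "y' = h x'"
      using surj by meson
    then show "?k (pplus Q y y') = pplus P (?k y) (?k y')"
      and "?k (pimp Q y y') = pimp P (?k y) (?k y')"
      by (simp_all add: preserves kh)
  qed (fact h')+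
qed

text \<open>A mutually inverse pair of homomorphisms is the form in which results computed in the
  concrete pocrims are carried to their copies.\<close>

lemma bpocrim_isoE:
  assumes "bpocrim_iso P Q"
  obtains h k where "bpocrim_hom P Q h" "bpocrim_hom Q P k"
    "\<And>x. x \<in> carrier P \<Longrightarrow> k (h x) = x" "\<And>y. y \<in> carrier Q \<Longrightarrow> h (k y) = y"
proof -
  obtain h where h: "bpocrim_hom P Q h" "bij_betw h (carrier P) (carrier Q)"
    using assms by (auto simp: bpocrim_iso_def)
  show thesis
    using h bij_betw_inv_into_left[OF h(2)] bij_betw_inv_into_right[OF h(2)]
    by (intro that[OF h(1) bpocrim_hom_inv[OF h]])
qed

lemma involutive_iso:
  assumes "bpocrim_iso P Q" and "involutive Q"
  shows "involutive P"
  unfolding involutive_def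
proof
  fix x assume x: "x \<in> carrier P"
  obtain h k where hk: "bpocrim_hom P Q h" "bpocrim_hom Q P k"
    "\<And>x. x \<in> carrier P \<Longrightarrow> k (h x) = x"
    using bpocrim_isoE[OF assms(1)] by metis
  have "dneg P x = dneg P (k (h x))" by (simp add: hk x)
  also have "\<dots> = k (dneg Q (h x))"
    by (rule hom_dneg[OF hk(2) bpocrim_homD(3)[OF hk(1) x], symmetric])
  also have "\<dots> = k (h x)" using assms(2) bpocrim_homD(3)[OF hk(1) x] by (simp add: involutive_def)
  finally show "dneg P x = x" by (simp add: hk x)
qed

section \<open>Assignments and naturality of the semantics\<close>

lemma assignments_apply: "\<alpha> \<in> assignments P \<Longrightarrow> \<alpha> i \<in> carrier P"
  by (auto simp: assignments_def)

lemma assignments_comp_hom: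
  "bpocrim_hom P Q h \<Longrightarrow> \<alpha> \<in> assignments P \<Longrightarrow> h \<circ> \<alpha> \<in> assignments Q"
  by (auto simp: assignments_def bpocrim_hom_def)

lemma assignments_comp_dneg:
  "bounded_pocrim P \<Longrightarrow> \<alpha> \<in> assignments P \<Longrightarrow> dneg P \<circ> \<alpha> \<in> assignments P"
  by (auto simp: assignments_def Pi_iff dneg_closed)

lemma standard_closed:
  "bounded_pocrim P \<Longrightarrow> \<alpha> \<in> assignments P \<Longrightarrow> standard P \<alpha> A \<in> carrier P"
  by (induction A) (auto simp: bounded_pocrimD(2,3,4) assignments_apply)

lemma standard_natural:
  assumes "bpocrim_hom P Q h" and "\<alpha> \<in> assignments P"
  shows "standard Q (h \<circ> \<alpha>) A = h (standard P \<alpha> A)"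
  by (induction A)
    (use assms in \<open>auto simp: bpocrim_homD standard_closed[OF bpocrim_homD(1)[OF assms(1)] assms(2)]\<close>)

lemma glivenko_natural:
  assumes "bpocrim_hom P Q h" and "\<alpha> \<in> assignments P"
  shows "glivenko Q (h \<circ> \<alpha>) A = h (glivenko P \<alpha> A)"
  using assms standard_closed[OF bpocrim_homD(1)[OF assms(1)] assms(2)]
  by (simp add: glivenko_def standard_natural hom_dneg)

lemma gentzen_natural:
  assumes h: "bpocrim_hom P Q h" and \<alpha>: "\<alpha> \<in> assignments P"
  shows "gentzen Q (h \<circ> \<alpha>) A = h (gentzen P \<alpha> A)"
proof -
  \<comment> \<open>Homomorphisms commute with double negation, so naturality reduces to that of
    \<open>standard\<close> at the doubly negated assignment.\<close>
  have "dneg Q \<circ> (h \<circ> \<alpha>) = h \<circ> (dneg P \<circ> \<alpha>)"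
    using assignments_apply[OF \<alpha>] by (auto simp: hom_dneg[OF h])
  then show ?thesis
    using standard_natural[OF h assignments_comp_dneg[OF bpocrim_homD(1)[OF h] \<alpha>]]
    by (simp add: gentzen_def)
qed

lemma is_semantics_gentzen: "is_semantics gentzen"
  unfolding is_semantics_def
proof (intro conjI allI impI ballI)
  fix P Q :: "'a bpocrim" and h \<alpha> assume "bpocrim_hom P Q h" "\<alpha> \<in> assignments P"
  then show "gentzen Q (h \<circ> \<alpha>) = h \<circ> gentzen P \<alpha>" by (auto simp: gentzen_natural)
qed (auto simp: gentzen_def standard_closed assignments_comp_dneg)

lemma is_semantics_glivenko: "is_semantics glivenko"
  unfolding is_semantics_def
proof (intro conjI allI impI ballI)
  fix P Q :: "'a bpocrim" and h \<alpha> assume "bpocrim_hom P Q h" "\<alpha> \<in> assignments P"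
  then show "glivenko Q (h \<circ> \<alpha>) = h \<circ> glivenko P \<alpha>" by (auto simp: glivenko_natural)
qed (auto simp: glivenko_def standard_closed dneg_closed)

section \<open>Criteria for double negation semantics\<close>

lemma DNS1_gentzen: "DNS1 C gentzen"
  unfolding DNS1_def
proof (intro ballI impI)
  fix P and \<alpha> :: "nat \<Rightarrow> 'a"
  assume "involutive P" "\<alpha> \<in> assignments P"
  then have "dneg P \<circ> \<alpha> = \<alpha>" by (auto simp: involutive_def assignments_apply)
  then show "gentzen P \<alpha> = standard P \<alpha>" by (simp add: gentzen_def)
qed

text \<open>Double negation is applied here to values of compound formulas; boundedness keeps these
  in the carrier, where involutivity fixes them.\<close>

lemma DNS1_glivenko:
  assumes "\<And>P. P \<in> C \<Longrightarrow> bounded_pocrim P"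
  shows "DNS1 C glivenko"
  using assms standard_closed by (fastforce simp: DNS1_def glivenko_def involutive_def)

text \<open>Double negation is idempotent on the carrier. As \<open>C\<close> may be the class of
  all bounded pocrims, this also yields the condition in its unrestricted form.\<close>

lemma DNS3_glivenko:
  assumes "\<And>P. P \<in> C \<Longrightarrow> bounded_pocrim P"
  shows "DNS3 C glivenko"
  using assms by (auto simp: DNS3_def glivenko_def fun_eq_iff dneg_dneg standard_closed)

text \<open>By \<open>image\<close>, every doubly negated assignment into \<open>P\<close> lifts
  along \<open>e\<close> to an assignment into \<open>L\<close>. Gentzen values in \<open>P\<close>
  are therefore images of standard values in \<open>L\<close>, and validity and invariance under
  double negation pass from \<open>L\<close> to \<open>P\<close>.\<close>

lemma gentzen_double_negation_semantics:
  assumes e: "bpocrim_hom L P e" and L: "involutive L"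
    and image: "dneg P ` carrier P \<subseteq> e ` carrier L"
  shows "double_negation_semantics {P, L} gentzen"
proof -
  have in_L: "\<exists>\<beta>\<in>assignments L. gentzen P \<alpha> = e \<circ> standard L \<beta>" if "\<alpha> \<in> assignments P" for \<alpha>
  proof -
    \<comment> \<open>The lift \<open>\<beta>\<close> chooses, for each variable, a preimage under
      \<open>e\<close> of its doubly negated value.\<close>
    have "\<forall>i. \<exists>y. y \<in> carrier L \<and> dneg P (\<alpha> i) = e y"
      using image assignments_apply[OF that] by blast
    then obtain \<beta> where \<beta>: "\<And>i. \<beta> i \<in> carrier L" "\<And>i. dneg P (\<alpha> i) = e (\<beta> i)" by metis
    have "\<beta> \<in> assignments L" using \<beta>(1) by (simp add: assignments_def)
    moreover have "dneg P \<circ> \<alpha> = e \<circ> \<beta>" using \<beta>(2) by auto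
    ultimately show ?thesis
      by (intro bexI[of _ \<beta>]) (auto simp: gentzen_def standard_natural[OF e])
  qed
  have gentzen_L: "gentzen L \<alpha> = standard L \<alpha>" if "\<alpha> \<in> assignments L" for \<alpha>
    using DNS1_gentzen[of "{L}"] L that by (simp add: DNS1_def)
  have fixed: "dneg L (standard L \<alpha> A) = standard L \<alpha> A" if "\<alpha> \<in> assignments L" for \<alpha> A
    using L standard_closed[OF bpocrim_homD(1)[OF e] that] by (simp add: involutive_def)
  have "DNS2 {P, L} gentzen"
    unfolding DNS2_def
  proof (intro allI impI ballI)
    fix A R \<alpha>
    assume "\<forall>P\<in>{P, L}. involutive P \<longrightarrow> (\<forall>\<alpha>\<in>assignments P. standard P \<alpha> A = pzero P)"
      and R: "R \<in> {P, L}" "\<alpha> \<in> assignments R"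
    then have "standard L \<beta> A = pzero L" if "\<beta> \<in> assignments L" for \<beta>
      using L that by blast
    then show "gentzen R \<alpha> A = pzero R"
      using R in_L[of \<alpha>] gentzen_L bpocrim_homD(4)[OF e] by auto
  qed
  moreover have "DNS3 {P, L} gentzen"
    unfolding DNS3_def
  proof (intro ballI ext)
    fix R \<alpha> A assume R: "R \<in> {P, L}" "\<alpha> \<in> assignments R"
    show "(dneg R \<circ> gentzen R \<alpha>) A = gentzen R \<alpha> A"
    proof (cases "R = L")
      case True
      then show ?thesis using R by (simp add: gentzen_L fixed)
    next
      case False
      then obtain \<beta> where \<beta>: "\<beta> \<in> assignments L" "gentzen P \<alpha> = e \<circ> standard L \<beta>" "R = P"
        using R in_L by blast
      then show ?thesis
        using fixed[OF \<beta>(1)] hom_dneg[OF e standard_closed[OF bpocrim_homD(1)[OF e] \<beta>(1)]]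
        by simp
    qed
  qed
  ultimately show ?thesis
    by (simp add: double_negation_semantics_def is_semantics_gentzen DNS1_gentzen)
qed

text \<open>If a formula is valid in \<open>R\<close>, naturality puts its standard values in
  \<open>Q\<close> into the kernel of \<open>f\<close>; \<open>kernel\<close> then says that their
  double negations, which are the Glivenko values, vanish.\<close>

lemma glivenko_double_negation_semantics:
  assumes f: "bpocrim_hom Q R f" and R: "involutive R"
    and kernel: "\<And>x. x \<in> carrier Q \<Longrightarrow> f x = pzero R \<Longrightarrow> dneg Q x = pzero Q"
  shows "double_negation_semantics {Q, R} glivenko"
proof -
  have bounded: "bounded_pocrim S" if "S \<in> {Q, R}" for S
    using that bpocrim_homD(1,2)[OF f] by blast
  have "DNS2 {Q, R} glivenko"
    unfolding DNS2_def
  proof (intro allI impI ballI)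
    fix A S \<alpha>
    assume "\<forall>S\<in>{Q, R}. involutive S \<longrightarrow> (\<forall>\<alpha>\<in>assignments S. standard S \<alpha> A = pzero S)"
      and S: "S \<in> {Q, R}" "\<alpha> \<in> assignments S"
    then have valid: "standard R \<beta> A = pzero R" if "\<beta> \<in> assignments R" for \<beta>
      using R that by blast
    show "glivenko S \<alpha> A = pzero S"
    proof (cases "S = R")
      case True
      then show ?thesis
        using S valid R bounded_pocrimD(1)[OF bounded[of R]]
        by (simp add: glivenko_def involutive_def)
    next
      case False
      then have \<alpha>: "\<alpha> \<in> assignments Q" and "S = Q" using S by auto
      have "f (standard Q \<alpha> A) = pzero R"
        using valid[OF assignments_comp_hom[OF f \<alpha>]] standard_natural[OF f \<alpha>] by simp
      then show ?thesis
        using kernel standard_closed[OF bpocrim_homD(1)[OF f] \<alpha>] \<open>S = Q\<close>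
        by (simp add: glivenko_def)
    qed
  qed
  moreover have "DNS1 {Q, R} glivenko" by (rule DNS1_glivenko) (rule bounded)
  moreover have "DNS3 {Q, R} glivenko" by (rule DNS3_glivenko) (rule bounded)
  ultimately show ?thesis
    by (simp add: double_negation_semantics_def is_semantics_glivenko)
qed

section \<open>Maps between the concrete pocrims\<close>

text \<open>On the carrier of \<open>std_L3\<close> only 1/2 reaches the last branch; it goes to p,
  which like 1/2 is its own negation.\<close>

definition L3_to_P4 :: "real \<Rightarrow> elt" where
  "L3_to_P4 x = (if x = 0 then E0 else if x = 1 then E1 else Ep)"

fun Q6_to_Q4 :: "elt \<Rightarrow> elt" where
  "Q6_to_Q4 Ep = E0"
| "Q6_to_Q4 Eq = Eu"
| "Q6_to_Q4 Er = Eu"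
| "Q6_to_Q4 Es = Ev"
| "Q6_to_Q4 x = x"

text \<open>Negation is \<open>1 - x\<close> on the carrier.\<close>

lemma involutive_std_L3: "involutive std_L3"
  by (auto simp: involutive_def dneg_def pneg_def std_L3_def)

text \<open>Negation swaps 0 with 1 and u with v.\<close>

lemma involutive_std_Q4: "involutive std_Q4"
  unfolding involutive_def by code_simp

lemma hom_L3_to_P4: "bpocrim_hom std_L3 std_P4 L3_to_P4"
  using bounded_pocrim_std_L3 bounded_pocrim_std_P4
  by (auto simp: bpocrim_hom_def std_L3_def std_P4_def L3_to_P4_def table_def position_def)

lemma dneg_std_P4_image: "dneg std_P4 ` carrier std_P4 \<subseteq> L3_to_P4 ` carrier std_L3"
proof -
  \<comment> \<open>Both p and q have negation p, so double negation sends q to p and fixes the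
    other three elements.\<close>
  have "dneg std_P4 ` carrier std_P4 = {E0, Ep, E1}" by code_simp
  also have "\<dots> = L3_to_P4 ` carrier std_L3" by (auto simp: L3_to_P4_def std_L3_def)
  finally show ?thesis by simp
qed

lemma hom_Q6_to_Q4: "bpocrim_hom std_Q6 std_Q4 Q6_to_Q4"
proof -
  have "(\<forall>x\<in>carrier std_Q6. Q6_to_Q4 x \<in> carrier std_Q4) \<and>
      Q6_to_Q4 (pzero std_Q6) = pzero std_Q4 \<and> Q6_to_Q4 (pone std_Q6) = pone std_Q4 \<and>
      (\<forall>x\<in>carrier std_Q6. \<forall>y\<in>carrier std_Q6.
        Q6_to_Q4 (pplus std_Q6 x y) = pplus std_Q4 (Q6_to_Q4 x) (Q6_to_Q4 y)) \<and>
      (\<forall>x\<in>carrier std_Q6. \<forall>y\<in>carrier std_Q6.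
        Q6_to_Q4 (pimp std_Q6 x y) = pimp std_Q4 (Q6_to_Q4 x) (Q6_to_Q4 y))"
    by code_simp
  then show ?thesis
    using bounded_pocrim_std_Q6 bounded_pocrim_std_Q4 by (simp add: bpocrim_hom_def Pi_iff)
qed

text \<open>Only 0 and p are mapped to 0, and the negation of p in \<open>std_Q6\<close> is already
  1.\<close>

lemma Q6_to_Q4_kernel:
  "\<forall>x\<in>carrier std_Q6. Q6_to_Q4 x = pzero std_Q4 \<longrightarrow> dneg std_Q6 x = pzero std_Q6"
  by code_simp

section \<open>Positive and negative results for isomorphic copies\<close>

lemma gentzen_P4_L3:
  assumes "bpocrim_iso L3 std_L3" and "bpocrim_iso P4 std_P4"
  shows "double_negation_semantics {P4, L3} gentzen"
proof -
  obtain h k where hk: "bpocrim_hom L3 std_L3 h" "bpocrim_hom std_L3 L3 k"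
    "\<And>y. y \<in> carrier std_L3 \<Longrightarrow> h (k y) = y"
    using bpocrim_isoE[OF assms(1)] by metis
  obtain h' k' where hk': "bpocrim_hom P4 std_P4 h'" "bpocrim_hom std_P4 P4 k'"
    "\<And>x. x \<in> carrier P4 \<Longrightarrow> k' (h' x) = x"
    using bpocrim_isoE[OF assms(2)] by metis
  \<comment> \<open>The concrete embedding conjugated by the isomorphisms: \<open>h\<close> enters
    \<open>std_L3\<close>, \<open>k'\<close> leaves \<open>std_P4\<close>.\<close>
  let ?e = "k' \<circ> (L3_to_P4 \<circ> h)"
  have "bpocrim_hom L3 P4 ?e"
    by (rule bpocrim_hom_comp[OF bpocrim_hom_comp[OF hk(1) hom_L3_to_P4] hk'(2)])
  moreover have "dneg P4 ` carrier P4 \<subseteq> ?e ` carrier L3"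
  proof
    fix z assume "z \<in> dneg P4 ` carrier P4"
    then obtain x where x: "x \<in> carrier P4" "z = dneg P4 x" by blast
    have h'x: "h' x \<in> carrier std_P4" by (rule bpocrim_homD(3)[OF hk'(1) x(1)])
    then obtain y where y: "y \<in> carrier std_L3" "dneg std_P4 (h' x) = L3_to_P4 y"
      using dneg_std_P4_image by blast
    have "z = k' (dneg std_P4 (h' x))" by (simp add: x hk'(3) hom_dneg[OF hk'(2) h'x])
    \<comment> \<open>Since \<open>h\<close> undoes \<open>k\<close>, the element \<open>k y\<close>
      of the copy plays the part of \<open>y\<close>.\<close>
    also have "\<dots> = ?e (k y)" by (simp add: y hk(3))
    finally show "z \<in> ?e ` carrier L3" using bpocrim_homD(3)[OF hk(2) y(1)] by blast
  qed
  ultimately show ?thesis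
    using gentzen_double_negation_semantics involutive_iso[OF assms(1) involutive_std_L3] by blast
qed

text \<open>Double negation elimination holds in every involutive pocrim, but its Glivenko value on
  \<open>P4\<close> is nonzero where the variable takes the value corresponding to q.\<close>

lemma not_DNS2_glivenko:
  assumes iso: "bpocrim_iso P4 std_P4" and C: "P4 \<in> C" "\<And>P. P \<in> C \<Longrightarrow> bounded_pocrim P"
  shows "\<not> DNS2 C glivenko"
proof
  assume DNS2: "DNS2 C glivenko"
  let ?A = "Lolli (Lolli (Lolli (Var 0) Falsum) Falsum) (Var 0)"
  obtain h k where hk: "bpocrim_hom P4 std_P4 h" "bpocrim_hom std_P4 P4 k"
    "\<And>y. y \<in> carrier std_P4 \<Longrightarrow> h (k y) = y"
    using bpocrim_isoE[OF iso] by metis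
  have \<alpha>: "(\<lambda>_. Eq) \<in> assignments std_P4" by (simp add: assignments_def std_P4_def)
  \<comment> \<open>Under involutivity the antecedent of \<open>?A\<close> has the value of
    \<open>Var 0\<close>, so the claim becomes reflexivity of \<open>pge P\<close>.\<close>
  have "standard P \<beta> ?A = pzero P" if "P \<in> C" "involutive P" "\<beta> \<in> assignments P" for P \<beta>
    using that assignments_apply[OF that(3), of 0] bounded_pocrimD(6)[OF C(2)]
    by (simp add: involutive_def dneg_def pneg_def pge_def)
  then have "glivenko P4 (k \<circ> (\<lambda>_. Eq)) ?A = pzero P4"
    using DNS2 C(1) assignments_comp_hom[OF hk(2) \<alpha>] unfolding DNS2_def by blast
  then have "h (k (glivenko std_P4 (\<lambda>_. Eq) ?A)) = pzero std_P4"
    using glivenko_natural[OF hk(2) \<alpha>] bpocrim_homD(4)[OF hk(1)] by metis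
  \<comment> \<open>The double negation of q is p, the implication from p to q is p, and double
    negation fixes p.\<close>
  moreover have "glivenko std_P4 (\<lambda>_. Eq) ?A = Ep" by code_simp
  moreover have "Ep \<in> carrier std_P4" "Ep \<noteq> pzero std_P4" by (simp_all add: std_P4_def)
  ultimately show False using hk(3) by simp
qed

lemma glivenko_Q6_Q4:
  assumes "bpocrim_iso Q4 std_Q4" and "bpocrim_iso Q6 std_Q6"
  shows "double_negation_semantics {Q6, Q4} glivenko"
proof -
  obtain h k where hk: "bpocrim_hom Q4 std_Q4 h" "bpocrim_hom std_Q4 Q4 k"
    "\<And>y. y \<in> carrier std_Q4 \<Longrightarrow> h (k y) = y"
    using bpocrim_isoE[OF assms(1)] by metis
  obtain h' k' where hk': "bpocrim_hom Q6 std_Q6 h'" "bpocrim_hom std_Q6 Q6 k'"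
    "\<And>x. x \<in> carrier Q6 \<Longrightarrow> k' (h' x) = x"
    using bpocrim_isoE[OF assms(2)] by metis
  let ?f = "k \<circ> (Q6_to_Q4 \<circ> h')"
  have "bpocrim_hom Q6 Q4 ?f"
    by (rule bpocrim_hom_comp[OF bpocrim_hom_comp[OF hk'(1) hom_Q6_to_Q4] hk(2)])
  moreover have "dneg Q6 x = pzero Q6" if x: "x \<in> carrier Q6" and "?f x = pzero Q4" for x
  proof -
    have h'x: "h' x \<in> carrier std_Q6" by (rule bpocrim_homD(3)[OF hk'(1) x])
    \<comment> \<open>Applying \<open>h\<close> cancels the outer \<open>k\<close> of
      \<open>?f\<close>, which brings the kernel condition back to the concrete tables.\<close>
    have "h (?f x) = pzero std_Q4" using that(2) bpocrim_homD(4)[OF hk(1)] by simp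
    then have "Q6_to_Q4 (h' x) = pzero std_Q4"
      using hk(3) bpocrim_homD(3)[OF hom_Q6_to_Q4 h'x] by simp
    then have "dneg std_Q6 (h' x) = pzero std_Q6" using Q6_to_Q4_kernel h'x by blast
    then show ?thesis
      using hom_dneg[OF hk'(2) h'x] hk'(3)[OF x] bpocrim_homD(4)[OF hk'(2)] by simp
  qed
  ultimately show ?thesis
    using glivenko_double_negation_semantics involutive_iso[OF assms(1) involutive_std_Q4] by blast
qed

lemma not_DNS3_gentzen_Q6:
  assumes iso: "bpocrim_iso Q6 std_Q6" and C: "Q6 \<in> C"
  shows "\<not> DNS3 C gentzen"
proof
  assume DNS3: "DNS3 C gentzen"
  let ?A = "Tensor (Var 0) (Var 0)"
  obtain h k where hk: "bpocrim_hom Q6 std_Q6 h" "bpocrim_hom std_Q6 Q6 k"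
    "\<And>y. y \<in> carrier std_Q6 \<Longrightarrow> h (k y) = y"
    using bpocrim_isoE[OF iso] by metis
  have \<alpha>: "(\<lambda>_. Eq) \<in> assignments std_Q6" by (simp add: assignments_def std_Q6_def)
  \<comment> \<open>The negation of q is s and that of s is q, so the assignment is unchanged by
    double negation and the value is q + q = r.\<close>
  have A: "gentzen std_Q6 (\<lambda>_. Eq) ?A = Er" by code_simp
  have r: "Er \<in> carrier std_Q6" by (simp add: std_Q6_def)
  have "dneg Q6 (gentzen Q6 (k \<circ> (\<lambda>_. Eq)) ?A) = gentzen Q6 (k \<circ> (\<lambda>_. Eq)) ?A"
    using DNS3 C assignments_comp_hom[OF hk(2) \<alpha>] unfolding DNS3_def by (metis comp_apply)
  then have "dneg Q6 (k Er) = k Er" by (simp only: gentzen_natural[OF hk(2) \<alpha>] A)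
  then have "dneg std_Q6 Er = Er"
    using hom_dneg[OF hk(1) bpocrim_homD(3)[OF hk(2) r]] hk(3)[OF r] by simp
  \<comment> \<open>The negation of r is s as well, so its double negation is q.\<close>
  moreover have "dneg std_Q6 Er \<noteq> Er" by code_simp
  ultimately show False by contradiction
qed

text \<open>Isomorphic copies in one type allow the real-valued \<open>std_L3\<close> and the
  tabulated \<open>std_P4\<close> to be represented in the same class. The unrestricted
  \<open>DNS3\<close> conjunct records that the Glivenko semantics meets the stronger form of that
  condition.\<close>

theorem theorem5p2p5:
  fixes L3 P4 Q4 Q6 :: "'a bpocrim"
  assumes "bpocrim_iso L3 std_L3"
    and "bpocrim_iso P4 std_P4"
    and "bpocrim_iso Q4 std_Q4"
    and "bpocrim_iso Q6 std_Q6"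
  shows "(double_negation_semantics {P4, L3} gentzen \<and>
          \<not> double_negation_semantics {P4, L3} glivenko) \<and>
         (double_negation_semantics {Q6, Q4} glivenko \<and>
          DNS3 {P. bounded_pocrim P} (glivenko :: 'a family) \<and>
          \<not> double_negation_semantics {Q6, Q4} gentzen)"
proof -
  have "\<And>P. P \<in> {P4, L3} \<Longrightarrow> bounded_pocrim P"
    using assms(1,2) by (auto simp: bpocrim_iso_def bpocrim_hom_def)
  \<comment> \<open>One failing condition refutes each negative claim: \<open>DNS2\<close> for
    Glivenko, \<open>DNS3\<close> for Gentzen.\<close>
  then have "\<not> DNS2 {P4, L3} glivenko" by (intro not_DNS2_glivenko[OF assms(2)]) auto
  moreover have "\<not> DNS3 {Q6, Q4} gentzen" by (rule not_DNS3_gentzen_Q6[OF assms(4)]) simp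
  moreover have "DNS3 {P. bounded_pocrim P} (glivenko :: 'a family)" by (rule DNS3_glivenko) simp
  ultimately show ?thesis
    using gentzen_P4_L3[OF assms(1,2)] glivenko_Q6_Q4[OF assms(3,4)]
    by (simp add: double_negation_semantics_def)
qed

end
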